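(* Let $(H,\mathfrak{R})$ be a quasi-triangular Hopf algebra over $\mathbb{C}$, $(\psi,J)$ a twist pair for it, $B$ a right comodule algebra over $H$, and $\mathfrak{K}\in B\otimes H$ a universal K-matrix. Then $\mathfrak{K}$ satisfies the $\psi$-twisted reflection equation in $B\otimes H\otimes H$: $$\mathfrak{K}_{12}\,(\mathfrak{R}^{\psi})_{32}\,\mathfrak{K}_{13}\,\mathfrak{R}_{23}=\mathfrak{R}^{\psi\psi}_{32}\,\mathfrak{K}_{13}\,\mathfrak{R}^{\psi}_{23}\,\mathfrak{K}_{12}.$$
   Context: A universal R-matrix of a Hopf algebra $H$ (coproduct $\Delta$, counit $\epsilon$) is an invertible $\mathfrak{R}\in H\otimes H$ with $\mathfrak{R}\Delta(x)=\Delta^{\mathrm{op}}(x)\mathfrak{R}$ for all $x\in H$, $(\Delta\otimes\mathrm{id})(\mathfrak{R})=\mathfrak{R}_{13}\mathfrak{R}_{23}$, $(\mathrm{id}\otimes\Delta)(\mathfrak{R})=\mathfrak{R}_{13}\mathfrak{R}_{12}$. A Drinfeld twist is an invertible $J\in H\otimes H$ with $(\epsilon\otimes\mathrm{id})(J)=1=(\mathrm{id}\otimes\epsilon)(J)$ and $(J\otimes1)(\Delta\otimes\mathrm{id})(J)=(1\otimes J)(\mathrm{id}\otimes\Delta)(J)$. For an algebra automorphism $\psi$ of $H$ put $\mathfrak{R}^{\psi}=(\psi\otimes\mathrm{id})(\mathfrak{R})$, $\mathfrak{R}^{\psi\psi}=(\psi\otimes\psi)(\mathfrak{R})$, and $\Delta^{\mathrm{op},\psi}=(\psi\otimes\psi)\circ\Delta^{\mathrm{op}}\circ\psi^{-1}$.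 A twist pair $(\psi,J)$ is an algebra automorphism $\psi$ of $H$ and a Drinfeld twist $J$ such that $\epsilon\circ\psi^{-1}=\epsilon$, $\Delta^{\mathrm{op},\psi}(x)=J\Delta(x)J^{-1}$ for all $x\in H$, and $\mathfrak{R}_{21}^{\psi\psi}=J_{21}\mathfrak{R}J^{-1}$. A right comodule algebra $B$ is an algebra with an algebra map $\delta:B\to B\otimes H$ satisfying $(\mathrm{id}\otimes\Delta)\delta=(\delta\otimes\mathrm{id})\delta$, $(\mathrm{id}\otimes\epsilon)\delta=\mathrm{id}$. $\mathfrak{K}\in B\otimes H$ is a universal K-matrix if (K1) $\mathfrak{K}\,\delta(b)=\delta^\psi(b)\,\mathfrak{K}$ for all $b\in B$, where $\delta^\psi=(\mathrm{id}\otimes\psi)\circ\delta$; (K2) $(\delta\otimes\mathrm{id})(\mathfrak{K})=(\mathfrak{R}^\psi)_{32}\mathfrak{K}_{13}\mathfrak{R}_{23}$; (K3) $(\mathrm{id}\otimes\Delta)(\mathfrak{K})=J_{23}^{-1}\mathfrak{K}_{13}\mathfrak{R}^\psi_{23}\mathfrak{K}_{12}$. Leg notation: $\mathfrak{K}_{12}=\mathfrak{K}\otimes1$, $\mathfrak{K}_{13}$ has components in legs 1 and 3; for $X=\sum a\otimes b\in H\otimes H$, $X_{23}=\sum1\otimes a\otimes b$ and $X_{32}=\sum1\otimes b\otimes a$; in particular $(\mathfrak{R}^\psi)_{32}$ and $\mathfrak{R}^{\psi\psi}_{32}$ are the flips of $\mathfrak{R}^\psi$, $\mathfrak{R}^{\psi\psi}$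 placed in legs 2,3. *)

theory Defs
  imports Complex_Main "HOL-Library.Poly_Mapping"
begin

section \<open>Complex vector spaces and complex algebras\<close>

class complex_vector = ab_group_add +
  fixes scaleC :: "complex \<Rightarrow> 'a \<Rightarrow> 'a" (infixr "*\<^sub>C" 75)
  assumes scaleC_add_right: "c *\<^sub>C (x + y) = c *\<^sub>C x + c *\<^sub>C y"
    and scaleC_add_left: "(c + d) *\<^sub>C x = c *\<^sub>C x + d *\<^sub>C x"
    and scaleC_scaleC: "c *\<^sub>C d *\<^sub>C x = (c * d) *\<^sub>C x"
    and scaleC_one: "1 *\<^sub>C x = x"

global_interpretation cvec: vector_space "scaleC :: complex \<Rightarrow> 'a \<Rightarrow> 'a::complex_vector"
  by unfold_locales
    (simp_all add: scaleC_add_right scaleC_add_left scaleC_scaleC scaleC_one)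

abbreviation clinear :: "('a::complex_vector \<Rightarrow> 'b::complex_vector) \<Rightarrow> bool" where
  "clinear \<equiv> Vector_Spaces.linear scaleC scaleC"

definition cbilinear ::
  "('a::complex_vector \<Rightarrow> 'b::complex_vector \<Rightarrow> 'c::complex_vector) \<Rightarrow> bool" where
  "cbilinear \<phi> \<longleftrightarrow> (\<forall>x. clinear (\<phi> x)) \<and> (\<forall>y. clinear (\<lambda>x. \<phi> x y))"

text \<open>Unital associative algebras over the complex numbers. The class \<^class>\<open>ring_1\<close> is not used
  because it excludes the zero algebra.\<close>

class complex_algebra = complex_vector + ring + monoid_mult +
  assumes scaleC_mult_left: "(c *\<^sub>C x) * y = c *\<^sub>C (x * y)"
    and scaleC_mult_right: "x * (c *\<^sub>C y) = c *\<^sub>C (x * y)"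

instantiation complex :: complex_algebra
begin
definition scaleC_complex :: "complex \<Rightarrow> complex \<Rightarrow> complex" where
  "scaleC_complex c x = c * x"
instance
  by standard (simp_all add: scaleC_complex_def algebra_simps)
end

definition calgebra_hom :: "('a::complex_algebra \<Rightarrow> 'b::complex_algebra) \<Rightarrow> bool" where
  "calgebra_hom f \<longleftrightarrow> clinear f \<and> f 1 = 1 \<and> (\<forall>x y. f (x * y) = f x * f y)"

definition calgebra_automorphism :: "('a::complex_algebra \<Rightarrow> 'a) \<Rightarrow> bool" where
  "calgebra_automorphism f \<longleftrightarrow> calgebra_hom f \<and> bij f"

text \<open>Two-sided invertibility in a possibly noncommutative monoid; \<open>minv x\<close> is only meaningful
  when \<open>x\<close> is invertible.\<close>

definition minvertible :: "'a::monoid_mult \<Rightarrow> bool" where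
  "minvertible x \<longleftrightarrow> (\<exists>y. x * y = 1 \<and> y * x = 1)"

definition minv :: "'a::monoid_mult \<Rightarrow> 'a" where
  "minv x = (THE y. x * y = 1 \<and> y * x = 1)"

lemma minv_unique:
  fixes x :: "'a::monoid_mult"
  assumes "x * y = 1" "y * x = 1"
  shows "minv x = y"
  unfolding minv_def
proof (rule the_equality)
  fix z assume z: "x * z = 1 \<and> z * x = 1"
  have "z = (y * x) * z" using assms by simp
  also have "\<dots> = y * (x * z)" by (simp only: mult.assoc)
  finally show "z = y" using z by simp
qed (use assms in simp)

lemma minvertible_minv:
  assumes "minvertible x"
  shows "x * minv x = 1" "minv x * x = 1"
  using assms minv_unique unfolding minvertible_def by metis+

lemma clinearI:
  assumes "\<And>x y. f (x + y) = f x + f y" "\<And>c x. f (c *\<^sub>C x) = c *\<^sub>C f x"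
  shows "clinear f"
  by unfold_locales (use assms in auto)

lemma clinear_add: "clinear f \<Longrightarrow> f (x + y) = f x + f y"
  by (rule module_hom.add[OF module_hom_iff_linear[THEN iffD2]])

lemma clinear_scale: "clinear f \<Longrightarrow> f (c *\<^sub>C x) = c *\<^sub>C f x"
  by (rule module_hom.scale[OF module_hom_iff_linear[THEN iffD2]])

lemma clinear_zero: "clinear f \<Longrightarrow> f 0 = 0"
  using clinear_scale[of f 0 0] by simp

lemma clinear_diff: "clinear f \<Longrightarrow> f (x - y) = f x - f y"
  using clinear_add[of f "x - y" y] by simp

lemma cbilinearI:
  assumes "\<And>x y z. \<phi> (x + y) z = \<phi> x z + \<phi> y z" "\<And>c x z. \<phi> (c *\<^sub>C x) z = c *\<^sub>C \<phi> x z"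
    and "\<And>x y z. \<phi> x (y + z) = \<phi> x y + \<phi> x z" "\<And>c x z. \<phi> x (c *\<^sub>C z) = c *\<^sub>C \<phi> x z"
  shows "cbilinear \<phi>"
  unfolding cbilinear_def by (auto intro!: clinearI simp: assms)

lemma cbilinear_simps:
  assumes "cbilinear \<phi>"
  shows "\<phi> (x + x') z = \<phi> x z + \<phi> x' z" "\<phi> (c *\<^sub>C x) z = c *\<^sub>C \<phi> x z"
    and "\<phi> x (z + z') = \<phi> x z + \<phi> x z'" "\<phi> x (c *\<^sub>C z) = c *\<^sub>C \<phi> x z"
  using assms clinear_add[of "\<lambda>x. \<phi> x z"] clinear_scale[of "\<lambda>x. \<phi> x z"]
    clinear_add[of "\<phi> x"] clinear_scale[of "\<phi> x"]
  unfolding cbilinear_def by blast+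


section \<open>Tensor products\<close>

text \<open>The tensor product is the free complex vector space on \<open>'a \<times> 'b\<close>, realised as finitely
  supported functions, modulo the span of the bilinearity relations.\<close>

instantiation poly_mapping :: (type, complex_vector) complex_vector
begin
definition scaleC_poly_mapping :: "complex \<Rightarrow> ('a \<Rightarrow>\<^sub>0 'b) \<Rightarrow> ('a \<Rightarrow>\<^sub>0 'b)" where
  "scaleC_poly_mapping c f = Poly_Mapping.map (scaleC c) f"

lemma lookup_scaleC: "Poly_Mapping.lookup (c *\<^sub>C f) k = c *\<^sub>C Poly_Mapping.lookup f k"
  for f :: "'a \<Rightarrow>\<^sub>0 'b"
  by (simp add: scaleC_poly_mapping_def Poly_Mapping.map.rep_eq when_def)

instance
  by standard
    (rule poly_mapping_eqI, simp add: lookup_scaleC lookup_add scaleC_add_left scaleC_add_right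
      scaleC_scaleC scaleC_one)+

end

lemma scaleC_single: "c *\<^sub>C Poly_Mapping.single k d = Poly_Mapping.single k (c *\<^sub>C d)"
  by (rule poly_mapping_eqI) (simp add: lookup_scaleC lookup_single when_def)

abbreviation free_pure :: "'a \<Rightarrow> 'b \<Rightarrow> ('a \<times> 'b) \<Rightarrow>\<^sub>0 complex" where
  "free_pure a b \<equiv> Poly_Mapping.single (a, b) 1"

definition tensor_relations ::
  "(('a::complex_vector \<times> 'b::complex_vector) \<Rightarrow>\<^sub>0 complex) set" where
  "tensor_relations =
     {free_pure (x + x') y - free_pure x y - free_pure x' y | x x' y. True} \<union>
     {free_pure x (y + y') - free_pure x y - free_pure x y' | x y y'. True} \<union>
     {free_pure (c *\<^sub>C x) y - c *\<^sub>C free_pure x y | c x y. True} \<union>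
     {free_pure x (c *\<^sub>C y) - c *\<^sub>C free_pure x y | c x y. True}"

definition tensor_eq ::
  "(('a::complex_vector \<times> 'b::complex_vector) \<Rightarrow>\<^sub>0 complex) \<Rightarrow> (('a \<times> 'b) \<Rightarrow>\<^sub>0 complex) \<Rightarrow> bool" where
  "tensor_eq f g \<longleftrightarrow> f - g \<in> cvec.span tensor_relations"

lemma equivp_tensor_eq:
  "equivp (tensor_eq :: (('a::complex_vector \<times> 'b::complex_vector) \<Rightarrow>\<^sub>0 complex) \<Rightarrow> _)"
proof (rule equivpI; (rule reflpI | rule sympI | rule transpI))
  fix f g h :: "('a \<times> 'b) \<Rightarrow>\<^sub>0 complex"
  show "tensor_eq f f"
    by (simp add: tensor_eq_def cvec.span_zero)
  show "tensor_eq g f" if "tensor_eq f g"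
    using cvec.span_neg[OF that[unfolded tensor_eq_def]] by (simp add: tensor_eq_def)
  show "tensor_eq f h" if "tensor_eq f g" "tensor_eq g h"
    using cvec.span_add[OF that[unfolded tensor_eq_def]] by (simp add: tensor_eq_def)
qed

quotient_type (overloaded) ('a, 'b) tensor (infixr "\<otimes>" 71) =
  "('a::complex_vector \<times> 'b::complex_vector) \<Rightarrow>\<^sub>0 complex" / tensor_eq
  by (rule equivp_tensor_eq)

lift_definition pure_tensor ::
  "'a::complex_vector \<Rightarrow> 'b::complex_vector \<Rightarrow> 'a \<otimes> 'b" (infixr "\<otimes>" 71) is free_pure .

instantiation tensor :: (complex_vector, complex_vector) complex_vector
begin
lift_definition zero_tensor :: "'a \<otimes> 'b" is 0 .
lift_definition plus_tensor :: "'a \<otimes> 'b \<Rightarrow> 'a \<otimes> 'b \<Rightarrow> 'a \<otimes> 'b" is "(+)"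
  unfolding tensor_eq_def
proof -
  fix f g f' g' :: "('a \<times> 'b) \<Rightarrow>\<^sub>0 complex"
  assume "f - g \<in> cvec.span tensor_relations" "f' - g' \<in> cvec.span tensor_relations"
  from cvec.span_add[OF this] show "f + f' - (g + g') \<in> cvec.span tensor_relations"
    by (simp add: algebra_simps)
qed
lift_definition minus_tensor :: "'a \<otimes> 'b \<Rightarrow> 'a \<otimes> 'b \<Rightarrow> 'a \<otimes> 'b" is "(-)"
  unfolding tensor_eq_def
proof -
  fix f g f' g' :: "('a \<times> 'b) \<Rightarrow>\<^sub>0 complex"
  assume "f - g \<in> cvec.span tensor_relations" "f' - g' \<in> cvec.span tensor_relations"
  from cvec.span_diff[OF this] show "f - f' - (g - g') \<in> cvec.span tensor_relations"
    by (simp add: algebra_simps)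
qed
lift_definition uminus_tensor :: "'a \<otimes> 'b \<Rightarrow> 'a \<otimes> 'b" is uminus
  unfolding tensor_eq_def
proof -
  fix f g :: "('a \<times> 'b) \<Rightarrow>\<^sub>0 complex"
  assume "f - g \<in> cvec.span tensor_relations"
  from cvec.span_neg[OF this] show "- f - - g \<in> cvec.span tensor_relations"
    by (simp add: algebra_simps)
qed
lift_definition scaleC_tensor :: "complex \<Rightarrow> 'a \<otimes> 'b \<Rightarrow> 'a \<otimes> 'b" is scaleC
  unfolding tensor_eq_def
proof -
  fix c and f g :: "('a \<times> 'b) \<Rightarrow>\<^sub>0 complex"
  assume "f - g \<in> cvec.span tensor_relations"
  from cvec.span_scale[OF this] show "c *\<^sub>C f - c *\<^sub>C g \<in> cvec.span tensor_relations"
    by (simp add: cvec.scale_right_diff_distrib)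
qed

instance
proof
  fix x y z :: "'a \<otimes> 'b" and c d :: complex
  obtain f g h where xyz: "x = abs_tensor f" "y = abs_tensor g" "z = abs_tensor h"
    by (metis Quotient_tensor Quotient_abs_rep)
  note abs_eqs = xyz zero_tensor.abs_eq plus_tensor.abs_eq minus_tensor.abs_eq
    uminus_tensor.abs_eq scaleC_tensor.abs_eq
  show "x + y + z = x + (y + z)" by (simp add: abs_eqs add.assoc)
  show "x + y = y + x" by (simp add: abs_eqs add.commute)
  show "0 + x = x" by (simp add: abs_eqs)
  show "- x + x = 0" by (simp add: abs_eqs)
  show "x - y = x + - y" by (simp add: abs_eqs)
  show "c *\<^sub>C (x + y) = c *\<^sub>C x + c *\<^sub>C y" by (simp add: abs_eqs scaleC_add_right)
  show "(c + d) *\<^sub>C x = c *\<^sub>C x + d *\<^sub>C x" by (simp add: abs_eqs scaleC_add_left)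
  show "c *\<^sub>C d *\<^sub>C x = (c * d) *\<^sub>C x" by (simp add: abs_eqs scaleC_scaleC)
  show "1 *\<^sub>C x = x" by (simp add: abs_eqs scaleC_one)
qed

end

lemma cbilinear_pure_tensor: "cbilinear (\<lambda>a b. a \<otimes> b)"
proof (rule cbilinearI)
  fix x y :: 'a and z :: 'b
  show "(x + y) \<otimes> z = x \<otimes> z + y \<otimes> z"
    by transfer
      (unfold tensor_eq_def tensor_relations_def diff_diff_eq[symmetric], rule cvec.span_base, blast)
next
  fix c and x :: 'a and z :: 'b
  show "(c *\<^sub>C x) \<otimes> z = c *\<^sub>C (x \<otimes> z)"
    by transfer
      (unfold tensor_eq_def tensor_relations_def diff_diff_eq[symmetric], rule cvec.span_base, blast)
next
  fix x :: 'a and y z :: 'b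
  show "x \<otimes> (y + z) = x \<otimes> y + x \<otimes> z"
    by transfer
      (unfold tensor_eq_def tensor_relations_def diff_diff_eq[symmetric], rule cvec.span_base, blast)
next
  fix c and x :: 'a and z :: 'b
  show "x \<otimes> (c *\<^sub>C z) = c *\<^sub>C (x \<otimes> z)"
    by transfer
      (unfold tensor_eq_def tensor_relations_def diff_diff_eq[symmetric], rule cvec.span_base, blast)
qed

lemmas pure_tensor_simps = cbilinear_simps[OF cbilinear_pure_tensor]

lemma tensor_induct [case_names pure add]:
  fixes t :: "'a::complex_vector \<otimes> 'b::complex_vector"
  assumes pure: "\<And>a b. P (a \<otimes> b)" and add: "\<And>s t. P s \<Longrightarrow> P t \<Longrightarrow> P (s + t)"
  shows "P t"
proof -
  have single: "P (abs_tensor (Poly_Mapping.single k c))" for k c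
  proof -
    obtain a b where k: "k = (a, b)" by fastforce
    have "Poly_Mapping.single k c = c *\<^sub>C free_pure a b"
      by (simp add: k scaleC_single scaleC_complex_def)
    then have "abs_tensor (Poly_Mapping.single k c) = c *\<^sub>C (a \<otimes> b)"
      by (simp only: scaleC_tensor.abs_eq pure_tensor.abs_eq)
    also have "\<dots> = (c *\<^sub>C a) \<otimes> b"
      by (rule pure_tensor_simps(2)[symmetric])
    finally show ?thesis by (simp add: pure)
  qed
  have "P (abs_tensor f)" for f
  proof (induction f rule: update_induct)
    case const
    then show ?case using single[of undefined 0] by simp
  next
    case (update f k c)
    have "Poly_Mapping.update k c f = Poly_Mapping.single k c + f"
      using update(1) by (intro poly_mapping_eqI)
        (auto simp: lookup_update lookup_add lookup_single when_def in_keys_iff)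
    then show ?case
      using add[OF single[of k c] update(3)] by (simp add: plus_tensor.abs_eq)
  qed
  then show ?thesis by (metis Quotient_tensor Quotient_abs_rep)
qed

text \<open>The linear map out of the tensor product induced by a bilinear map. It is computed on an
  arbitrary representative, so it is only meaningful when \<open>\<phi>\<close> is bilinear.\<close>

definition free_extend ::
  "('a \<Rightarrow> 'b \<Rightarrow> 'c::complex_vector) \<Rightarrow> (('a \<times> 'b) \<Rightarrow>\<^sub>0 complex) \<Rightarrow> 'c" where
  "free_extend \<phi> f = (\<Sum>(a, b)\<in>Poly_Mapping.keys f. Poly_Mapping.lookup f (a, b) *\<^sub>C \<phi> a b)"

definition tensor_lift ::
  "('a::complex_vector \<Rightarrow> 'b::complex_vector \<Rightarrow> 'c::complex_vector) \<Rightarrow> 'a \<otimes> 'b \<Rightarrow> 'c" where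
  "tensor_lift \<phi> t = free_extend \<phi> (rep_tensor t)"

lemma free_extend_superset:
  assumes "finite A" "Poly_Mapping.keys f \<subseteq> A"
  shows "free_extend \<phi> f = (\<Sum>(a, b)\<in>A. Poly_Mapping.lookup f (a, b) *\<^sub>C \<phi> a b)"
  unfolding free_extend_def
  by (rule sum.mono_neutral_left) (use assms in \<open>auto simp: in_keys_iff\<close>)

lemma clinear_free_extend: "clinear (free_extend \<phi>)"
proof (rule clinearI)
  fix f g :: "('a \<times> 'b) \<Rightarrow>\<^sub>0 complex"
  let ?A = "Poly_Mapping.keys f \<union> Poly_Mapping.keys g"
  show "free_extend \<phi> (f + g) = free_extend \<phi> f + free_extend \<phi> g"
    using keys_add[of f g]
    by (simp add: free_extend_superset[of ?A] lookup_add scaleC_add_left sum.distrib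
        split_beta)
next
  fix c and f :: "('a \<times> 'b) \<Rightarrow>\<^sub>0 complex"
  have "Poly_Mapping.keys (c *\<^sub>C f) \<subseteq> Poly_Mapping.keys f"
    by (auto simp: in_keys_iff lookup_scaleC)
  then show "free_extend \<phi> (c *\<^sub>C f) = c *\<^sub>C free_extend \<phi> f"
    by (simp add: free_extend_superset[of "Poly_Mapping.keys f"] lookup_scaleC scaleC_complex_def
        cvec.scale_sum_right split_beta)
qed

lemma free_extend_pure: "free_extend \<phi> (free_pure a b) = \<phi> a b"
  by (simp add: free_extend_def scaleC_one)

lemma free_extend_tensor_eq:
  assumes "cbilinear \<phi>" "tensor_eq f g"
  shows "free_extend \<phi> f = free_extend \<phi> g"
proof -
  note lin = clinear_free_extend[of \<phi>]
  have "free_extend \<phi> h = 0" if "h \<in> cvec.span tensor_relations" for h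
    using that
  proof (induction rule: cvec.span_induct)
    case base
    show ?case
      unfolding cvec.subspace_def
      by (auto simp: clinear_zero[OF lin] clinear_add[OF lin] clinear_scale[OF lin])
  next
    case (step h)
    then show ?case
      by (auto simp: tensor_relations_def clinear_diff[OF lin] clinear_scale[OF lin]
          free_extend_pure cbilinear_simps[OF assms(1)])
  qed
  with assms(2) show ?thesis
    unfolding tensor_eq_def by (fastforce simp: clinear_diff[OF lin])
qed

lemma tensor_lift_abs: "cbilinear \<phi> \<Longrightarrow> tensor_lift \<phi> (abs_tensor f) = free_extend \<phi> f"
  unfolding tensor_lift_def
  by (rule free_extend_tensor_eq) (auto intro: Quotient3_rep_abs[OF Quotient3_tensor] 
      simp: equivp_reflp[OF equivp_tensor_eq])

lemma clinear_tensor_lift: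
  assumes "cbilinear \<phi>"
  shows "clinear (tensor_lift \<phi>)"
proof (rule clinearI)
  fix s t :: "'a \<otimes> 'b" and c
  obtain f g where [simp]: "s = abs_tensor f" "t = abs_tensor g"
    by (metis Quotient_tensor Quotient_abs_rep)
  show "tensor_lift \<phi> (s + t) = tensor_lift \<phi> s + tensor_lift \<phi> t"
    by (simp add: plus_tensor.abs_eq tensor_lift_abs assms clinear_add[OF clinear_free_extend])
  show "tensor_lift \<phi> (c *\<^sub>C s) = c *\<^sub>C tensor_lift \<phi> s"
    by (simp add: scaleC_tensor.abs_eq tensor_lift_abs assms clinear_scale[OF clinear_free_extend])
qed

lemma tensor_lift_pure: "cbilinear \<phi> \<Longrightarrow> tensor_lift \<phi> (a \<otimes> b) = \<phi> a b"
  by (simp add: pure_tensor.abs_eq tensor_lift_abs free_extend_pure)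

lemma tensor_linear_eqI:
  assumes "clinear f" "clinear g" "\<And>a b. f (a \<otimes> b) = g (a \<otimes> b)"
  shows "f t = g t"
  by (induction t rule: tensor_induct)
    (simp_all add: assms(3) clinear_add[OF assms(1)] clinear_add[OF assms(2)])

lemma clinear_plus: "clinear f \<Longrightarrow> clinear g \<Longrightarrow> clinear (\<lambda>x. f x + g x)"
  by (rule clinearI) (auto simp: clinear_add clinear_scale scaleC_add_right)

lemma tensor_lift_add:
  "tensor_lift (\<lambda>a b. \<phi> a b + \<psi> a b) t = tensor_lift \<phi> t + tensor_lift \<psi> t"
  by (simp add: tensor_lift_def free_extend_def scaleC_add_right sum.distrib split_beta)

lemma tensor_lift_scale: "tensor_lift (\<lambda>a b. c *\<^sub>C \<phi> a b) t = c *\<^sub>C tensor_lift \<phi> t"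
  by (simp add: tensor_lift_def free_extend_def scaleC_scaleC mult.commute
      cvec.scale_sum_right split_beta)

lemma clinear_mult_right: "clinear (\<lambda>x. x * (a::'a::complex_algebra))"
  by (rule clinearI) (auto simp: distrib_right scaleC_mult_left)

lemma clinear_mult_left: "clinear (\<lambda>x. (a::'a::complex_algebra) * x)"
  by (rule clinearI) (auto simp: distrib_left scaleC_mult_right)


section \<open>The tensor product of two algebras\<close>

lemma cbilinear_tensor_mult_inner:
  fixes a :: "'a::complex_algebra" and b :: "'b::complex_algebra"
  shows "cbilinear (\<lambda>c d. (a * c) \<otimes> (b * d))"
  by (rule cbilinearI)
    (simp_all add: distrib_left scaleC_mult_right pure_tensor_simps)

lemma cbilinear_tensor_mult_outer:
  fixes t :: "'a::complex_algebra \<otimes> 'b::complex_algebra"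
  shows "cbilinear (\<lambda>a b. tensor_lift (\<lambda>c d. (a * c) \<otimes> (b * d)) t)"
  by (rule cbilinearI)
    (simp_all add: distrib_right scaleC_mult_left pure_tensor_simps tensor_lift_add
      tensor_lift_scale)

instantiation tensor :: (complex_algebra, complex_algebra) complex_algebra
begin

definition one_tensor :: "'a \<otimes> 'b" where
  "one_tensor = 1 \<otimes> 1"

definition times_tensor :: "'a \<otimes> 'b \<Rightarrow> 'a \<otimes> 'b \<Rightarrow> 'a \<otimes> 'b" where
  "times_tensor s t = tensor_lift (\<lambda>a b. tensor_lift (\<lambda>c d. (a * c) \<otimes> (b * d)) t) s"

lemma tensor_mult_pure_raw: "(a \<otimes> b) * (c \<otimes> d) = (a * c) \<otimes> (b * d)" for a c :: 'a and b d :: 'b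
  by (simp only: times_tensor_def tensor_lift_pure[OF cbilinear_tensor_mult_outer])
    (rule tensor_lift_pure[OF cbilinear_tensor_mult_inner])

lemma clinear_times_tensor_left: "clinear (\<lambda>s. s * t)" for t :: "'a \<otimes> 'b"
  unfolding times_tensor_def by (rule clinear_tensor_lift) (rule cbilinear_tensor_mult_outer)

lemma clinear_times_tensor_right: "clinear (\<lambda>t. s * t)" for s :: "'a \<otimes> 'b"
proof (induction s rule: tensor_induct)
  case (pure a b)
  show ?case
    by (simp add: times_tensor_def tensor_lift_pure cbilinear_tensor_mult_outer
        clinear_tensor_lift cbilinear_tensor_mult_inner)
next
  case (add s t)
  then show ?case
    by (simp add: clinear_add[OF clinear_times_tensor_left] clinear_plus)
qed

instance
proof
  note l = clinear_add[OF clinear_times_tensor_left] clinear_scale[OF clinear_times_tensor_left]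
  note r = clinear_add[OF clinear_times_tensor_right] clinear_scale[OF clinear_times_tensor_right]
  fix x y z :: "'a \<otimes> 'b" and c :: complex
  show "(x + y) * z = x * z + y * z" by (rule l)
  show "x * (y + z) = x * y + x * z" by (rule r)
  show "(c *\<^sub>C x) * y = c *\<^sub>C (x * y)" by (rule l)
  show "x * (c *\<^sub>C y) = c *\<^sub>C (x * y)" by (rule r)
  show "1 * x = x"
    by (induction x rule: tensor_induct) (simp_all add: one_tensor_def tensor_mult_pure_raw r)
  show "x * 1 = x"
    by (induction x rule: tensor_induct) (simp_all add: one_tensor_def tensor_mult_pure_raw l)
  show "x * y * z = x * (y * z)"
  proof (induction x rule: tensor_induct)
    case (pure a b)
    show ?case
    proof (induction y rule: tensor_induct)
      case (pure a' b')
      show ?case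
        by (induction z rule: tensor_induct) (simp_all add: tensor_mult_pure_raw r mult.assoc)
    qed (simp add: l r)
  qed (simp add: l r)
qed

end

lemma tensor_mult_pure: "(a \<otimes> b) * (c \<otimes> d) = (a * c) \<otimes> (b * d)"
  by (rule tensor_mult_pure_raw)


section \<open>Canonical maps and leg notation\<close>

definition tensor_map ::
  "('a::complex_vector \<Rightarrow> 'c::complex_vector) \<Rightarrow> ('b::complex_vector \<Rightarrow> 'd::complex_vector)
    \<Rightarrow> 'a \<otimes> 'b \<Rightarrow> 'c \<otimes> 'd" where
  "tensor_map f g = tensor_lift (\<lambda>a b. f a \<otimes> g b)"

definition tensor_flip :: "'a::complex_vector \<otimes> 'b::complex_vector \<Rightarrow> 'b \<otimes> 'a" where
  "tensor_flip = tensor_lift (\<lambda>a b. b \<otimes> a)"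

definition tensor_assoc ::
  "('a::complex_vector \<otimes> 'b::complex_vector) \<otimes> 'c::complex_vector \<Rightarrow> 'a \<otimes> 'b \<otimes> 'c" where
  "tensor_assoc = tensor_lift (\<lambda>s c. tensor_lift (\<lambda>a b. a \<otimes> b \<otimes> c) s)"

definition tensor_lunit :: "complex \<otimes> 'a::complex_vector \<Rightarrow> 'a" where
  "tensor_lunit = tensor_lift (\<lambda>c a. c *\<^sub>C a)"

definition tensor_runit :: "'a::complex_vector \<otimes> complex \<Rightarrow> 'a" where
  "tensor_runit = tensor_lift (\<lambda>a c. c *\<^sub>C a)"

text \<open>Threefold tensor products are bracketed to the right throughout. The map \<open>leg32\<close> sends
  \<open>a \<otimes> b\<close> to \<open>1 \<otimes> b \<otimes> a\<close>.\<close>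

definition leg12 ::
  "'a::complex_algebra \<otimes> 'b::complex_algebra \<Rightarrow> 'a \<otimes> 'b \<otimes> 'c::complex_algebra" where
  "leg12 = tensor_map id (\<lambda>b. b \<otimes> 1)"

definition leg13 ::
  "'a::complex_algebra \<otimes> 'c::complex_algebra \<Rightarrow> 'a \<otimes> 'b::complex_algebra \<otimes> 'c" where
  "leg13 = tensor_map id (\<lambda>c. 1 \<otimes> c)"

definition leg23 ::
  "'b::complex_algebra \<otimes> 'c::complex_algebra \<Rightarrow> 'a::complex_algebra \<otimes> 'b \<otimes> 'c" where
  "leg23 t = 1 \<otimes> t"

definition leg32 ::
  "'c::complex_algebra \<otimes> 'b::complex_algebra \<Rightarrow> 'a::complex_algebra \<otimes> 'b \<otimes> 'c" where
  "leg32 t = 1 \<otimes> tensor_flip t"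

lemma cbilinear_tensor_map:
  assumes "clinear f" "clinear g"
  shows "cbilinear (\<lambda>a b. f a \<otimes> g b)"
  by (rule cbilinearI)
    (simp_all add: clinear_add[OF assms(1)] clinear_add[OF assms(2)] clinear_scale[OF assms(1)]
      clinear_scale[OF assms(2)] pure_tensor_simps)

lemma clinear_id: "clinear id" "clinear (\<lambda>x. x)"
  by (simp_all add: clinearI)

lemma tensor_map_pure: "clinear f \<Longrightarrow> clinear g \<Longrightarrow> tensor_map f g (a \<otimes> b) = f a \<otimes> g b"
  by (simp add: tensor_map_def tensor_lift_pure cbilinear_tensor_map)

lemma clinear_tensor_map: "clinear f \<Longrightarrow> clinear g \<Longrightarrow> clinear (tensor_map f g)"
  by (simp add: tensor_map_def clinear_tensor_lift cbilinear_tensor_map)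

lemma cbilinear_flip: "cbilinear (\<lambda>a b. b \<otimes> a)"
  by (rule cbilinearI) (simp_all add: pure_tensor_simps)

lemma tensor_flip_pure: "tensor_flip (a \<otimes> b) = b \<otimes> a"
  by (simp add: tensor_flip_def tensor_lift_pure cbilinear_flip)

lemma clinear_tensor_flip: "clinear tensor_flip"
  by (simp add: tensor_flip_def clinear_tensor_lift cbilinear_flip)

lemma cbilinear_assoc_inner: "cbilinear (\<lambda>a b. a \<otimes> b \<otimes> c)"
  by (rule cbilinearI) (simp_all add: pure_tensor_simps)

lemma cbilinear_assoc_outer: "cbilinear (\<lambda>s c. tensor_lift (\<lambda>a b. a \<otimes> b \<otimes> c) s)"
  by (rule cbilinearI)
    (simp_all add: pure_tensor_simps tensor_lift_add tensor_lift_scale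
      clinear_add[OF clinear_tensor_lift[OF cbilinear_assoc_inner]]
      clinear_scale[OF clinear_tensor_lift[OF cbilinear_assoc_inner]])

lemma tensor_assoc_pure: "tensor_assoc ((a \<otimes> b) \<otimes> c) = a \<otimes> b \<otimes> c"
  by (simp add: tensor_assoc_def tensor_lift_pure cbilinear_assoc_outer cbilinear_assoc_inner)

lemma clinear_tensor_assoc: "clinear tensor_assoc"
  by (simp add: tensor_assoc_def clinear_tensor_lift cbilinear_assoc_outer)

lemma tensor_lunit_pure: "tensor_lunit (c \<otimes> a) = c *\<^sub>C a"
  unfolding tensor_lunit_def
  by (rule tensor_lift_pure, rule cbilinearI)
    (simp_all add: scaleC_add_left scaleC_add_right scaleC_scaleC scaleC_complex_def mult.commute)

lemma tensor_runit_pure: "tensor_runit (a \<otimes> c) = c *\<^sub>C a"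
  unfolding tensor_runit_def
  by (rule tensor_lift_pure, rule cbilinearI)
    (simp_all add: scaleC_add_left scaleC_add_right scaleC_scaleC scaleC_complex_def mult.commute)

lemma leg12_pure: "leg12 (a \<otimes> b) = a \<otimes> b \<otimes> 1"
  unfolding leg12_def
  by (subst tensor_map_pure) (auto intro!: clinearI simp: pure_tensor_simps)

lemma leg13_pure: "leg13 (a \<otimes> c) = a \<otimes> 1 \<otimes> c"
  unfolding leg13_def
  by (subst tensor_map_pure) (auto intro!: clinearI simp: pure_tensor_simps)

lemma leg32_pure: "leg32 (a \<otimes> b) = 1 \<otimes> b \<otimes> a"
  by (simp add: leg32_def tensor_flip_pure)


section \<open>Hopf algebras, twist pairs and K-matrices\<close>

definition hopf_algebra ::
  "('h::complex_algebra \<Rightarrow> 'h \<otimes> 'h) \<Rightarrow> ('h \<Rightarrow> complex) \<Rightarrow> ('h \<Rightarrow> 'h) \<Rightarrow> bool" where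
  "hopf_algebra \<Delta> \<epsilon> S \<longleftrightarrow>
     calgebra_hom \<Delta> \<and> calgebra_hom \<epsilon> \<and> clinear S \<and>
     (\<forall>x. tensor_assoc (tensor_map \<Delta> id (\<Delta> x)) = tensor_map id \<Delta> (\<Delta> x)) \<and>
     (\<forall>x. tensor_lunit (tensor_map \<epsilon> id (\<Delta> x)) = x) \<and>
     (\<forall>x. tensor_runit (tensor_map id \<epsilon> (\<Delta> x)) = x) \<and>
     (\<forall>x. tensor_lift (*) (tensor_map S id (\<Delta> x)) = \<epsilon> x *\<^sub>C 1) \<and>
     (\<forall>x. tensor_lift (*) (tensor_map id S (\<Delta> x)) = \<epsilon> x *\<^sub>C 1)"

definition universal_R_matrix ::
  "('h::complex_algebra \<Rightarrow> 'h \<otimes> 'h) \<Rightarrow> 'h \<otimes> 'h \<Rightarrow> bool" where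
  "universal_R_matrix \<Delta> R \<longleftrightarrow>
     minvertible R \<and>
     (\<forall>x. R * \<Delta> x = tensor_flip (\<Delta> x) * R) \<and>
     tensor_assoc (tensor_map \<Delta> id R) = leg13 R * leg23 R \<and>
     tensor_map id \<Delta> R = leg13 R * leg12 R"

definition quasitriangular_hopf_algebra ::
  "('h::complex_algebra \<Rightarrow> 'h \<otimes> 'h) \<Rightarrow> ('h \<Rightarrow> complex) \<Rightarrow> ('h \<Rightarrow> 'h) \<Rightarrow> 'h \<otimes> 'h \<Rightarrow> bool" where
  "quasitriangular_hopf_algebra \<Delta> \<epsilon> S R \<longleftrightarrow> hopf_algebra \<Delta> \<epsilon> S \<and> universal_R_matrix \<Delta> R"

definition drinfeld_twist ::
  "('h::complex_algebra \<Rightarrow> 'h \<otimes> 'h) \<Rightarrow> ('h \<Rightarrow> complex) \<Rightarrow> 'h \<otimes> 'h \<Rightarrow> bool" where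
  "drinfeld_twist \<Delta> \<epsilon> J \<longleftrightarrow>
     minvertible J \<and>
     tensor_lunit (tensor_map \<epsilon> id J) = 1 \<and>
     tensor_runit (tensor_map id \<epsilon> J) = 1 \<and>
     leg12 J * tensor_assoc (tensor_map \<Delta> id J) = leg23 J * tensor_map id \<Delta> J"

definition twist_pair ::
  "('h::complex_algebra \<Rightarrow> 'h \<otimes> 'h) \<Rightarrow> ('h \<Rightarrow> complex) \<Rightarrow> 'h \<otimes> 'h
    \<Rightarrow> ('h \<Rightarrow> 'h) \<Rightarrow> 'h \<otimes> 'h \<Rightarrow> bool" where
  "twist_pair \<Delta> \<epsilon> R \<psi> J \<longleftrightarrow>
     calgebra_automorphism \<psi> \<and> drinfeld_twist \<Delta> \<epsilon> J \<and>
     \<epsilon> \<circ> inv \<psi> = \<epsilon> \<and>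
     (\<forall>x. tensor_map \<psi> \<psi> (tensor_flip (\<Delta> (inv \<psi> x))) = J * \<Delta> x * minv J) \<and>
     tensor_flip (tensor_map \<psi> \<psi> R) = tensor_flip J * R * minv J"

definition right_comodule_algebra ::
  "('h::complex_algebra \<Rightarrow> 'h \<otimes> 'h) \<Rightarrow> ('h \<Rightarrow> complex)
    \<Rightarrow> ('b::complex_algebra \<Rightarrow> 'b \<otimes> 'h) \<Rightarrow> bool" where
  "right_comodule_algebra \<Delta> \<epsilon> \<delta> \<longleftrightarrow>
     calgebra_hom \<delta> \<and>
     (\<forall>b. tensor_map id \<Delta> (\<delta> b) = tensor_assoc (tensor_map \<delta> id (\<delta> b))) \<and>
     (\<forall>b. tensor_runit (tensor_map id \<epsilon> (\<delta> b)) = b)"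

definition universal_K_matrix ::
  "('h::complex_algebra \<Rightarrow> 'h \<otimes> 'h) \<Rightarrow> 'h \<otimes> 'h \<Rightarrow> ('h \<Rightarrow> 'h) \<Rightarrow> 'h \<otimes> 'h
    \<Rightarrow> ('b::complex_algebra \<Rightarrow> 'b \<otimes> 'h) \<Rightarrow> 'b \<otimes> 'h \<Rightarrow> bool" where
  "universal_K_matrix \<Delta> R \<psi> J \<delta> K \<longleftrightarrow>
     (\<forall>b. K * \<delta> b = tensor_map id \<psi> (\<delta> b) * K) \<and>
     tensor_assoc (tensor_map \<delta> id K) = leg32 (tensor_map \<psi> id R) * leg13 K * leg23 R \<and>
     tensor_map id \<Delta> K = leg23 (minv J) * leg13 K * leg23 (tensor_map \<psi> id R) * leg12 K"

end

theory Submission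
  imports Defs
begin

text \<open>Because \<open>tensor_map \<delta> id K\<close> lies in the image of \<open>\<delta>\<close> tensored with the
  identity, the intertwining property (K1) lets \<open>leg12 K\<close> move past it at the price of applying
  \<open>\<psi>\<close> to the second leg. Expanding both sides by (K2) gives the reflection equation.\<close>

text \<open>Both sides are additive in \<open>s\<close> and in \<open>t\<close>, so
  \<open>tensor_induct\<close> reduces the claim to pure tensors, where multiplication is
  factorwise.\<close>

lemma tensor_map_mult:
  assumes "calgebra_hom f" "calgebra_hom g"
  shows "tensor_map f g (s * t) = tensor_map f g s * tensor_map f g t"
proof -
  have l: "clinear f" "clinear g"
    and m: "\<And>x y. f (x * y) = f x * f y" "\<And>x y. g (x * y) = g x * g y"
    using assms by (auto simp: calgebra_hom_def)
  note add = clinear_add[OF clinear_tensor_map[OF l]]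
  show ?thesis
  proof (induction s rule: tensor_induct)
    case (pure a b)
    show ?case
      by (induction t rule: tensor_induct)
        (simp_all add: tensor_mult_pure tensor_map_pure[OF l] m distrib_left add)
  qed (simp add: distrib_right add)
qed

lemma calgebra_hom_id: "calgebra_hom id"
  by (simp add: calgebra_hom_def clinear_id)

lemma calgebra_hom_tensor_map:
  assumes "calgebra_hom f" "calgebra_hom g"
  shows "calgebra_hom (tensor_map f g)"
  using assms tensor_map_mult[OF assms]
  by (simp add: calgebra_hom_def clinear_tensor_map tensor_map_pure one_tensor_def)

text \<open>With this, product identities can be proved in the left bracketing, where the first two
  legs form one factor, and then carried over to the right bracketing.\<close>

lemma tensor_assoc_mult: "tensor_assoc (s * t) = tensor_assoc s * tensor_assoc t"
  for s :: "('a::complex_algebra \<otimes> 'b::complex_algebra) \<otimes> 'c::complex_algebra"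
proof -
  note add = clinear_add[OF clinear_tensor_assoc]
  \<comment> \<open>A pure tensor of the outer product still has arbitrary tensors \<open>p\<close>
    and \<open>q\<close> as left factors, so these need an induction of their own.\<close>
  have *: "tensor_assoc ((p \<otimes> c) * (q \<otimes> d)) = tensor_assoc (p \<otimes> c) * tensor_assoc (q \<otimes> d)"
    for p q :: "'a \<otimes> 'b" and c d :: 'c
  proof (induction p rule: tensor_induct)
    case (pure a b)
    show ?case
      by (induction q rule: tensor_induct)
        (simp_all add: tensor_mult_pure tensor_assoc_pure distrib_left add pure_tensor_simps)
  qed (simp add: distrib_right add pure_tensor_simps)
  show ?thesis
  proof (induction s rule: tensor_induct)
    case (pure p c)
    show ?case
      by (induction t rule: tensor_induct) (simp_all only: * distrib_left add)
  qed (simp only: distrib_right add)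
qed

text \<open>In this form the embedded element is a pure tensor of the left bracketing and multiplies
  factorwise.\<close>

lemma leg12_eq_tensor_assoc: "leg12 s = tensor_assoc (s \<otimes> 1)"
proof (induction s rule: tensor_induct)
  case (add s t)
  have "clinear (\<lambda>b. b \<otimes> (1::'c))"
    by (rule clinearI) (simp_all add: pure_tensor_simps)
  then have "clinear (leg12 :: 'a \<otimes> 'b \<Rightarrow> 'a \<otimes> 'b \<otimes> 'c)"
    unfolding leg12_def by (intro clinear_tensor_map clinear_id)
  with add show ?case
    by (simp add: clinear_add pure_tensor_simps clinear_add[OF clinear_tensor_assoc])
qed (simp add: leg12_pure tensor_assoc_pure)

text \<open>Naturality of the associator; it moves the action of \<psi> on the second leg from one
  bracketing to the other.\<close>

lemma tensor_assoc_natural: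
  assumes "clinear f" "clinear g" "clinear h"
  shows "tensor_map f (tensor_map g h) (tensor_assoc t) =
    tensor_assoc (tensor_map (tensor_map f g) h t)"
proof -
  note l = assms clinear_tensor_map[OF assms(1,2)] clinear_tensor_map[OF assms(2,3)]
  note add = clinear_add[OF clinear_tensor_assoc] clinear_add[OF clinear_tensor_map[OF l(1,5)]]
    clinear_add[OF clinear_tensor_map[OF l(4,3)]] clinear_add[OF l(4)]
  show ?thesis
  proof (induction t rule: tensor_induct)
    case (pure s c)
    show ?case
      by (induction s rule: tensor_induct)
        (simp_all add: l tensor_assoc_pure tensor_map_pure add pure_tensor_simps)
  qed (simp add: add)
qed

text \<open>For \<open>t = b \<otimes> h\<close> this is K1 at \<open>b\<close> in the first two
  legs, while \<open>h\<close> in the third leg only meets the unit. Additivity in \<open>t\<close>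
  does the rest.\<close>

lemma leg12_intertwines_coaction:
  assumes "clinear \<delta>" "clinear \<psi>" and K1: "\<And>b. K * \<delta> b = tensor_map id \<psi> (\<delta> b) * K"
  shows "leg12 K * tensor_assoc (tensor_map \<delta> id t) =
    tensor_map id (tensor_map \<psi> id) (tensor_assoc (tensor_map \<delta> id t)) * leg12 K"
proof -
  note l = clinear_id assms(1,2) clinear_tensor_map
  \<comment> \<open>In the left bracketing K1 applies directly to the left factor; the associator is
    applied to both sides afterwards.\<close>
  have "(K \<otimes> 1) * tensor_map \<delta> id t =
    tensor_map (tensor_map id \<psi>) id (tensor_map \<delta> id t) * (K \<otimes> 1)"
    by (induction t rule: tensor_induct)
      (simp_all add: l tensor_map_pure tensor_mult_pure K1 distrib_left distrib_right
        clinear_add del: id_apply, simp)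
  then show ?thesis
    by (simp add: leg12_eq_tensor_assoc tensor_assoc_natural l flip: tensor_assoc_mult)
qed

text \<open>The middle leg holds only the unit, which \<open>g\<close> fixes, so \<open>g\<close>
  leaves no trace.\<close>

lemma tensor_map_leg13:
  assumes "clinear f" "clinear g" "clinear h" "g 1 = 1"
  shows "tensor_map f (tensor_map g h) (leg13 t) = leg13 (tensor_map f h t)"
proof -
  note l = assms clinear_tensor_map[OF assms(2,3)]
  have leg13: "clinear leg13"
    unfolding leg13_def by (intro clinear_tensor_map clinear_id clinearI)
      (simp_all add: pure_tensor_simps)
  show ?thesis
    by (induction t rule: tensor_induct)
      (simp_all add: l leg13_pure tensor_map_pure clinear_add[OF clinear_tensor_map]
        clinear_add[OF leg13])
qed

lemma tensor_map_leg23: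
  assumes "clinear f" "clinear g" "clinear h" "f 1 = 1"
  shows "tensor_map f (tensor_map g h) (leg23 t) = leg23 (tensor_map g h t)"
  by (simp add: leg23_def tensor_map_pure assms clinear_tensor_map)

lemma tensor_map_flip:
  assumes "clinear f" "clinear g"
  shows "tensor_map f g (tensor_flip t) = tensor_flip (tensor_map g f t)"
  by (induction t rule: tensor_induct)
    (simp_all add: assms tensor_flip_pure tensor_map_pure clinear_add[OF clinear_tensor_map]
      clinear_add[OF clinear_tensor_flip])

text \<open>The flip inside \<open>leg32\<close> makes \<open>g\<close> and \<open>h\<close> trade
  places: the second leg carries the second component of \<open>t\<close>.\<close>

lemma tensor_map_leg32:
  assumes "clinear f" "clinear g" "clinear h" "f 1 = 1"
  shows "tensor_map f (tensor_map g h) (leg32 t) = leg32 (tensor_map h g t)"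
  by (simp add: leg32_def tensor_map_pure assms clinear_tensor_map tensor_map_flip)

lemma tensor_map_tensor_map:
  assumes "clinear f" "clinear g" "clinear f'" "clinear g'"
  shows "tensor_map f g (tensor_map f' g' t) = tensor_map (f \<circ> f') (g \<circ> g') t"
proof -
  have "clinear (f \<circ> f')" "clinear (g \<circ> g')"
    using assms by (simp_all add: clinearI clinear_add clinear_scale)
  then show ?thesis
    by (induction t rule: tensor_induct)
      (simp_all add: assms tensor_map_pure clinear_add[OF clinear_tensor_map])
qed

lemma tensor_map_id: "tensor_map id id t = t"
  by (induction t rule: tensor_induct)
    (simp_all add: tensor_map_pure clinear_id clinear_add[OF clinear_tensor_map])

theorem proposition2p10:
  fixes \<Delta> :: "'h::complex_algebra \<Rightarrow> 'h \<otimes> 'h"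
    and \<epsilon> :: "'h \<Rightarrow> complex"
    and S :: "'h \<Rightarrow> 'h"
    and R :: "'h \<otimes> 'h"
    and \<psi> :: "'h \<Rightarrow> 'h"
    and J :: "'h \<otimes> 'h"
    and \<delta> :: "'b::complex_algebra \<Rightarrow> 'b \<otimes> 'h"
    and K :: "'b \<otimes> 'h"
  assumes "quasitriangular_hopf_algebra \<Delta> \<epsilon> S R"
    and "twist_pair \<Delta> \<epsilon> R \<psi> J"
    and "right_comodule_algebra \<Delta> \<epsilon> \<delta>"
    and "universal_K_matrix \<Delta> R \<psi> J \<delta> K"
  shows "leg12 K * leg32 (tensor_map \<psi> id R) * leg13 K * leg23 R =
    leg32 (tensor_map \<psi> \<psi> R) * leg13 K * leg23 (tensor_map \<psi> id R) * leg12 K"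
proof -
  have \<psi>: "calgebra_hom \<psi>" "clinear \<psi>" "\<psi> 1 = 1"
    using assms(2) by (auto simp: twist_pair_def calgebra_automorphism_def calgebra_hom_def)
  have \<delta>: "clinear \<delta>"
    using assms(3) by (simp add: right_comodule_algebra_def calgebra_hom_def)
  have K1: "K * \<delta> b = tensor_map id \<psi> (\<delta> b) * K" for b
    using assms(4) by (simp add: universal_K_matrix_def)
  have K2: "tensor_assoc (tensor_map \<delta> id K) =
      leg32 (tensor_map \<psi> id R) * leg13 K * leg23 R"
    using assms(4) by (simp add: universal_K_matrix_def)
  let ?F = "tensor_map id (tensor_map \<psi> id) :: 'b \<otimes> 'h \<otimes> 'h \<Rightarrow> 'b \<otimes> 'h \<otimes> 'h"
  have mult: "?F (x * y) = ?F x * ?F y" for x y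
    by (intro tensor_map_mult calgebra_hom_tensor_map calgebra_hom_id \<psi>)
  have "leg12 K * leg32 (tensor_map \<psi> id R) * leg13 K * leg23 R =
      leg12 K * tensor_assoc (tensor_map \<delta> id K)"
    by (simp add: K2 mult.assoc)
  \<comment> \<open>The intertwining lemma is taken at \<open>t = K\<close>, so \<open>K\<close> is
    both the intertwiner and the tensor being moved past.\<close>
  also have "\<dots> = ?F (leg32 (tensor_map \<psi> id R) * leg13 K * leg23 R) * leg12 K"
    using leg12_intertwines_coaction[OF \<delta> \<psi>(2) K1, of K] by (simp only: K2)
  \<comment> \<open>Leg 2 holds the second component of the flipped factor, which thus gains its
    second \<psi>, the unit in \<open>leg13 K\<close>, and the first component of \<open>R\<close>
    in \<open>leg23 R\<close>.\<close>
  also have "?F (leg32 (tensor_map \<psi> id R) * leg13 K * leg23 R) =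
      leg32 (tensor_map \<psi> \<psi> R) * leg13 K * leg23 (tensor_map \<psi> id R)"
    by (simp add: mult tensor_map_leg13 tensor_map_leg23 tensor_map_leg32 tensor_map_tensor_map
        tensor_map_id clinear_id \<psi>)
  finally show ?thesis .
qed

end
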